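(* If a normed space $X$ over $\mathbb{F}\in\{\mathbb{R},\mathbb{C}\}$ is a direct sum of spaces $\{X_n:n\in\mathbb{N}\}$, and $T$ is a bounded linear operator on $X$ such that $T(X_1)=\{0\}$ and, for every $n>1$, $$T(X_n)\subseteq\Big(\sum\nolimits_{k<n}^{\oplus}X_k\Big)^{-},$$ then $T$ is null-orbit reflexive and $\mathrm{nullOrbRef}(T)=\mathrm{nullOrb}(T)$.
   Context: Here $\mathbb{N}=\{1,2,\ldots\}$, $\sum_{k<n}^{\oplus}X_k$ is the direct sum of $X_1,\ldots,X_{n-1}$, and $(\cdot)^-$ denotes norm closure in $X$. $\mathrm{nullOrb}(T)=\{0,1,T,T^2,\ldots\}$, where $1$ is the identity operator. $\mathrm{nullOrbRef}(T)$ is the set of all bounded linear operators $S$ on $X$ such that, for every $x\in X$, $Sx$ lies in the norm closure of $\mathrm{nullOrb}(T)x=\{Ax:A\in\mathrm{nullOrb}(T)\}$. $T$ is null-orbit reflexive if $\mathrm{nullOrbRef}(T)$ equals the closure of $\mathrm{nullOrb}(T)$ in the strong operator topology. *)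

theory Defs
  imports "HOL-Analysis.Analysis"
begin

text \<open>
  Normed spaces over the real or the complex field, treated uniformly. The scalars range over the
  class \<open>real_normed_field\<close>: it contains \<open>real\<close> and \<open>complex\<close> and, by the Gelfand--Mazur theorem, every
  member is isometrically isomorphic to one of these two. The norm is that of the type \<open>'a\<close>, whose
  own real vector space structure is the restriction of scalars along \<open>of_real\<close>.
\<close>

locale normed_space_over = vector_space smul
  for smul :: "'f::real_normed_field \<Rightarrow> 'a::real_normed_vector \<Rightarrow> 'a" +
  assumes smul_of_real: "smul (of_real r) x = r *\<^sub>R x"
    and norm_smul: "norm (smul c x) = norm c * norm x"

lemma normed_space_over_real: "normed_space_over ((*\<^sub>R) :: real \<Rightarrow> 'a::real_normed_vector \<Rightarrow> 'a)"
  by unfold_locales (auto simp: algebra_simps)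

lemma normed_space_over_complex: "normed_space_over ((*) :: complex \<Rightarrow> complex \<Rightarrow> complex)"
  by unfold_locales (auto simp: algebra_simps norm_mult scaleR_conv_of_real)

text \<open>
  The type \<open>'a \<Rightarrow>\<^sub>L 'a\<close> only guarantees real linearity; linearity over the scalars is added here.
\<close>

definition bounded_ops ::
    "('f::real_normed_field \<Rightarrow> 'a::real_normed_vector \<Rightarrow> 'a) \<Rightarrow> ('a \<Rightarrow>\<^sub>L 'a) set" where
  "bounded_ops smul = {A. Vector_Spaces.linear smul smul (blinfun_apply A)}"

definition nullOrb :: "('a::real_normed_vector \<Rightarrow>\<^sub>L 'a) \<Rightarrow> ('a \<Rightarrow>\<^sub>L 'a) set" where
  "nullOrb T = insert 0 (range (\<lambda>n. ((o\<^sub>L) T ^^ n) id_blinfun))"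

lemma blinfun_apply_power:
  fixes T :: "'a::real_normed_vector \<Rightarrow>\<^sub>L 'a"
  shows "blinfun_apply (((o\<^sub>L) T ^^ n) id_blinfun) = blinfun_apply T ^^ n"
  by (induction n) (auto simp: fun_eq_iff)

definition nullOrbRef ::
    "('f::real_normed_field \<Rightarrow> 'a::real_normed_vector \<Rightarrow> 'a) \<Rightarrow> ('a \<Rightarrow>\<^sub>L 'a) \<Rightarrow> ('a \<Rightarrow>\<^sub>L 'a) set" where
  "nullOrbRef smul T =
     {S \<in> bounded_ops smul. \<forall>x. blinfun_apply S x \<in> closure ((\<lambda>A. blinfun_apply A x) ` nullOrb T)}"

definition null_orbit_reflexive ::
    "('f::real_normed_field \<Rightarrow> 'a::real_normed_vector \<Rightarrow> 'a) \<Rightarrow> ('a \<Rightarrow>\<^sub>L 'a) \<Rightarrow> bool" where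
  "null_orbit_reflexive smul T \<longleftrightarrow>
     nullOrbRef smul T =
       subtopology strong_operator_topology (bounded_ops smul) closure_of nullOrb T"

text \<open>
  The sum of the subspaces \<open>X k\<close>, \<open>k \<in> J\<close>, consists of the finite sums; its directness is expressed
  by \<open>independent_subspaces\<close>.
\<close>

definition sum_of_subspaces ::
    "('f::field \<Rightarrow> 'a::ab_group_add \<Rightarrow> 'a) \<Rightarrow> (nat \<Rightarrow> 'a set) \<Rightarrow> nat set \<Rightarrow> 'a set" where
  "sum_of_subspaces smul X J = module.span smul (\<Union>k\<in>J. X k)"

definition independent_subspaces ::
    "('f::field \<Rightarrow> 'a::ab_group_add \<Rightarrow> 'a) \<Rightarrow> (nat \<Rightarrow> 'a set) \<Rightarrow> nat set \<Rightarrow> bool" where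
  "independent_subspaces smul X J \<longleftrightarrow>
     (\<forall>k\<in>J. module.subspace smul (X k)) \<and>
     (\<forall>I x. finite I \<and> I \<subseteq> J \<and> (\<forall>k\<in>I. x k \<in> X k) \<and> (\<Sum>k\<in>I. x k) = 0 \<longrightarrow> (\<forall>k\<in>I. x k = 0))"

text \<open>
  The whole space is the direct sum of the \<open>X k\<close> in the sense of normed spaces: the algebraic direct
  sum is dense. This covers the algebraic direct sum, where it is the whole space, as well as
  completed ones such as Hilbert space or \<open>l\<^sup>p\<close> direct sums with \<open>p < \<infinity>\<close>, where it is not. No
  summand has to be closed.
\<close>

definition is_direct_sum ::
    "('f::real_normed_field \<Rightarrow> 'a::real_normed_vector \<Rightarrow> 'a) \<Rightarrow> (nat \<Rightarrow> 'a set) \<Rightarrow> nat set \<Rightarrow> bool" where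
  "is_direct_sum smul X J \<longleftrightarrow>
     independent_subspaces smul X J \<and> closure (sum_of_subspaces smul X J) = UNIV"

lemma is_direct_sum_algebraic:
  assumes "independent_subspaces smul X J" and "sum_of_subspaces smul X J = UNIV"
  shows "is_direct_sum smul X J"
  using assms by (simp add: is_direct_sum_def)

end

theory Submission
  imports Defs
begin

text \<open>
  The hypotheses make the vectors annihilated by some power of \<open>T\<close> dense. On \<open>ker T\<^sup>n\<close> the orbits are
  finite, so \<open>ker T\<^sup>n\<close> is a finite union of the subspaces on which an operator \<open>S\<close> in
  \<open>nullOrbRef(T)\<close> agrees with \<open>0\<close> or with some \<open>T\<^sup>k\<close>, \<open>k < n\<close>; as the scalar field is infinite, one of
  these subspaces is everything. If \<open>S x \<noteq> 0\<close> for some \<open>x\<close> in \<open>ker T\<^sup>n\<close>, the exponent is determined by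
  \<open>S x\<close>, because the nonzero terms of the orbit of a nilpotent vector are distinct. Hence the
  exponent does not depend on \<open>n\<close>, and \<open>S\<close> agrees with one element of \<open>nullOrb(T)\<close> on a dense set.
\<close>

text \<open>Induction on the number of subspaces. If \<open>V\<close> is not covered by
  \<open>F\<close> alone, some \<open>x\<close> of \<open>V\<close> lies outside every member of
  \<open>F\<close>, hence in \<open>W\<close>; a vector \<open>y\<close> of \<open>V\<close> outside
  \<open>W\<close> then leads to a contradiction through the line
  \<open>y + t *\<^sub>R x\<close>.\<close>

lemma subspace_subset_finite_Union:
  fixes V :: "'a::real_vector set"
  assumes "finite F" "subspace V" "\<And>W. W \<in> F \<Longrightarrow> subspace W" "V \<subseteq> \<Union>F"
  shows "\<exists>W\<in>F. V \<subseteq> W"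
  using assms(1,3,4)
proof (induction F rule: finite_induct)
  case empty
  then show ?case using subspace_0[OF assms(2)] by auto
next
  case (insert W F)
  show ?case
  proof (cases "V \<subseteq> \<Union>F")
    case True
    then show ?thesis using insert by blast
  next
    case False
    then obtain x where x: "x \<in> V" "x \<notin> \<Union>F" by blast
    then have "x \<in> W" using insert.prems by blast
    have W: "subspace W" using insert.prems by simp
    have "V \<subseteq> W"
    proof
      fix y assume "y \<in> V"
      show "y \<in> W"
      proof (rule ccontr)
        assume "y \<notin> W"
        have "y + t *\<^sub>R x \<in> \<Union>F" for t
        proof -
          have "y + t *\<^sub>R x \<in> V"
            using \<open>y \<in> V\<close> x(1) assms(2) by (simp add: subspace_add subspace_scale)
          moreover have "y + t *\<^sub>R x \<notin> W"
          proof
            assume "y + t *\<^sub>R x \<in> W"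
            then have "(y + t *\<^sub>R x) - t *\<^sub>R x \<in> W"
              using W \<open>x \<in> W\<close> by (blast intro: subspace_diff subspace_scale)
            then show False using \<open>y \<notin> W\<close> by simp
          qed
          ultimately show ?thesis using insert.prems by blast
        qed
        then obtain U where U: "\<And>t. U t \<in> F" "\<And>t. y + t *\<^sub>R x \<in> U t"
          unfolding Union_iff by metis
        \<comment> \<open>Pigeonhole: infinitely many points of the line lie in finitely many
          subspaces, so two of them share one. Their difference is a nonzero multiple of
          \<open>x\<close>, which puts \<open>x\<close> in a member of \<open>F\<close>.\<close>
        have "\<not> inj U"
        proof
          assume "inj U"
          moreover have "finite (range U)"
            using U(1) \<open>finite F\<close> by (meson finite_subset image_subsetI)
          ultimately show False
            using finite_imageD infinite_UNIV_char_0 by blast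
        qed
        then obtain s t where st: "s \<noteq> t" "U s = U t" by (auto simp: inj_def)
        have Us: "subspace (U s)" using U(1) insert.prems by simp
        have "(y + s *\<^sub>R x) - (y + t *\<^sub>R x) \<in> U s"
          using subspace_diff[OF Us U(2)] U(2)[of t] st(2) by metis
        then have "(s - t) *\<^sub>R x \<in> U s" by (simp add: algebra_simps)
        then have "inverse (s - t) *\<^sub>R ((s - t) *\<^sub>R x) \<in> U s"
          by (rule subspace_scale[OF Us])
        then have "x \<in> U s" using st(1) by simp
        then show False using x(2) U(1) by blast
      qed
    qed
    then show ?thesis by blast
  qed
qed

lemma funpow_annihilated_mono:
  fixes f :: "'a::zero \<Rightarrow> 'a"
  assumes "f 0 = 0" "(f ^^ n) x = 0" "n \<le> m"
  shows "(f ^^ m) x = 0"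
proof -
  have "(f ^^ i) 0 = 0" for i using assms(1) by (induction i) auto
  then show ?thesis
    using assms(2,3) funpow_add[of "m - n" n f] by simp
qed

text \<open>A repetition at \<open>i < j\<close> makes the orbit periodic from \<open>i\<close> on,
  with period \<open>d = j - i\<close>. Going \<open>n\<close> periods further reaches an exponent
  of at least \<open>n\<close>, where the orbit has already vanished.\<close>

lemma nilpotent_orbit_inj:
  fixes f :: "'a::zero \<Rightarrow> 'a"
  assumes "f 0 = 0" "(f ^^ n) x = 0" "(f ^^ i) x = (f ^^ j) x" "(f ^^ i) x \<noteq> 0"
  shows "i = j"
proof -
  have *: "(f ^^ i) x = 0" if "i < j" "(f ^^ i) x = (f ^^ j) x" for i j
  proof -
    obtain d where j: "j = d + i" "d > 0" using \<open>i < j\<close> less_imp_add_positive add.commute by metis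
    have "(f ^^ i) x = (f ^^ (m * d + i)) x" for m
    proof (induction m)
      case (Suc m)
      have "(f ^^ (Suc m * d + i)) x = (f ^^ (m * d)) ((f ^^ (d + i)) x)"
        using funpow_add[of "m * d" "d + i" f] by (simp add: add_ac)
      also have "\<dots> = (f ^^ (m * d + i)) x" using that(2) j by (simp add: funpow_add)
      finally show ?case using Suc by simp
    qed simp
    moreover have "(f ^^ (n * d + i)) x = 0"
      using j(2) by (intro funpow_annihilated_mono[of f, OF assms(1,2)]) (simp add: trans_le_add1)
    ultimately show ?thesis by metis
  qed
  show ?thesis using *[of i j] *[of j i] assms(3,4) by (metis nat_neq_iff)
qed

lemma nullOrb_image:
  "(\<lambda>A. blinfun_apply A x) ` nullOrb T = insert 0 (range (\<lambda>n. (blinfun_apply T ^^ n) x))"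
  by (auto simp: nullOrb_def blinfun_apply_power image_image)

lemma subspace_eq_set: "subspace {x. blinfun_apply A x = blinfun_apply B x}"
  by (simp add: subspace_def blinfun.add_right blinfun.scaleR_right)

lemma nullOrb_of_dense_nilpotent:
  fixes T S :: "'a::real_normed_vector \<Rightarrow>\<^sub>L 'a"
  assumes dense: "closure {x. \<exists>n. (blinfun_apply T ^^ n) x = 0} = UNIV"
    and ref: "\<And>x. blinfun_apply S x \<in> closure ((\<lambda>A. blinfun_apply A x) ` nullOrb T)"
  shows "S \<in> nullOrb T"
proof -
  let ?P = "\<lambda>n. ((o\<^sub>L) T ^^ n) id_blinfun"
  have P: "blinfun_apply (?P n) x = (blinfun_apply T ^^ n) x" for n x
    by (simp add: blinfun_apply_power)
  define K where "K n = {x. blinfun_apply (?P n) x = 0}" for n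
  have K_mono: "K n \<subseteq> K m" if "n \<le> m" for n m
    using funpow_annihilated_mono[of "blinfun_apply T"] that by (auto simp: K_def P)
  \<comment> \<open>Two bounded operators agree on a closed set, so agreement on the dense union of
    the kernels \<open>K n\<close> suffices.\<close>
  have eqI: "S = A" if "\<And>n x. x \<in> K n \<Longrightarrow> blinfun_apply S x = blinfun_apply A x" for A
  proof -
    have "closed {x. blinfun_apply S x = blinfun_apply A x}"
      by (intro closed_Collect_eq continuous_intros)
    moreover have "{x. \<exists>n. (blinfun_apply T ^^ n) x = 0} \<subseteq> {x. blinfun_apply S x = blinfun_apply A x}"
      using that by (auto simp: K_def P)
    ultimately show ?thesis using dense closure_minimal by (intro blinfun_eqI) blast
  qed
  have agree: "\<exists>A \<in> insert 0 (?P ` {..<n}). \<forall>x\<in>K n. blinfun_apply S x = blinfun_apply A x" for n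
  proof -
    let ?E = "\<lambda>A. {x. blinfun_apply S x = blinfun_apply A x}"
    have "\<exists>W \<in> ?E ` insert 0 (?P ` {..<n}). K n \<subseteq> W"
    proof (rule subspace_subset_finite_Union)
      show "subspace (K n)"
        using subspace_eq_set[of "?P n" 0] by (simp add: K_def)
      show "subspace W" if "W \<in> ?E ` insert 0 (?P ` {..<n})" for W
        using that subspace_eq_set[of S] by blast
      show "K n \<subseteq> \<Union> (?E ` insert 0 (?P ` {..<n}))"
      proof
        fix x assume x: "x \<in> K n"
        \<comment> \<open>All powers from the \<open>n\<close>-th on kill \<open>x\<close>, so the
          orbit of \<open>x\<close> lies in this finite set. Finite sets are closed, hence passing
          to the closure adds nothing and \<open>S x\<close> itself is one of these values.\<close>
        let ?O = "insert 0 ((\<lambda>i. (blinfun_apply T ^^ i) x) ` {..<n})"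
        have "(blinfun_apply T ^^ i) x \<in> ?O" for i
          using funpow_annihilated_mono[of "blinfun_apply T" n x i] x
          by (cases "i < n") (auto simp: K_def P)
        then have "(\<lambda>A. blinfun_apply A x) ` nullOrb T \<subseteq> ?O"
          unfolding nullOrb_image by blast
        moreover have "closed ?O" by (intro finite_imp_closed) simp
        ultimately have "blinfun_apply S x \<in> ?O"
          using ref[of x] closure_minimal by blast
        then show "x \<in> \<Union> (?E ` insert 0 (?P ` {..<n}))" by (auto simp: P)
      qed
    qed auto
    then show ?thesis by blast
  qed
  show ?thesis
  proof (cases "\<forall>n. \<forall>x\<in>K n. blinfun_apply S x = 0")
    case True
    then have "S = 0" by (intro eqI) auto
    then show ?thesis by (simp add: nullOrb_def)
  next
    case False
    then obtain n x where x: "x \<in> K n" "blinfun_apply S x \<noteq> 0" by blast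
    \<comment> \<open>As \<open>x\<close> also lies in \<open>K m\<close> and \<open>S x\<close> is
      nonzero, the alternative that \<open>S\<close> is zero on \<open>K m\<close> is
      excluded.\<close>
    have pow: "\<exists>i. \<forall>y\<in>K m. blinfun_apply S y = (blinfun_apply T ^^ i) y" if "n \<le> m" for m
      using agree[of m] K_mono[OF that] x by (fastforce simp: P)
    obtain k where k: "\<And>y. y \<in> K n \<Longrightarrow> blinfun_apply S y = (blinfun_apply T ^^ k) y"
      using pow[of n] by blast
    have "S = ?P k"
    proof (rule eqI)
      fix m y assume y: "y \<in> K m"
      \<comment> \<open>The exponent may depend on the kernel. \<open>K (max n m)\<close> contains
        both \<open>x\<close> and \<open>y\<close>, so its exponent can be compared with
        \<open>k\<close> at \<open>x\<close> and then used at \<open>y\<close>.\<close>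
      obtain i where i: "\<And>y. y \<in> K (max n m) \<Longrightarrow> blinfun_apply S y = (blinfun_apply T ^^ i) y"
        using pow[of "max n m"] by auto
      have "x \<in> K (max n m)" using x K_mono[of n "max n m"] by auto
      then have "(blinfun_apply T ^^ k) x = (blinfun_apply T ^^ i) x" using i k x by metis
      moreover have "(blinfun_apply T ^^ k) x \<noteq> 0" using k x by metis
      ultimately have "k = i"
        using nilpotent_orbit_inj[of "blinfun_apply T" n x k i] x by (simp add: K_def P)
      moreover have "y \<in> K (max n m)" using y K_mono[of m "max n m"] by auto
      ultimately show "blinfun_apply S y = blinfun_apply (?P k) y" using i by (simp add: P)
    qed
    then show ?thesis by (simp add: nullOrb_def)
  qed
qed

context vector_space
begin

lemma linear_funpow:
  assumes "Vector_Spaces.linear scale scale f"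
  shows "Vector_Spaces.linear scale scale (f ^^ n)"
proof (induction n)
  case 0
  then show ?case using linear_id by (simp add: id_def)
next
  case (Suc n)
  then show ?case using Vector_Spaces.linear_compose[OF Suc assms] by (simp add: o_def)
qed

text \<open>The set is the union of an increasing chain of kernels. It must be closed under
  \<open>scale\<close>, and not only under real scalars, in order to contain the span of the
  summands.\<close>

lemma subspace_nilpotent_vectors:
  assumes "Vector_Spaces.linear scale scale f"
  shows "subspace {x. \<exists>n. (f ^^ n) x = 0}"
proof (rule subspaceI)
  interpret pair: vector_space_pair scale scale by unfold_locales
  have lin: "Vector_Spaces.linear scale scale (f ^^ n)" for n
    using linear_funpow[OF assms] .
  have f0: "f 0 = 0" using assms by (rule pair.linear_0)
  show "0 \<in> {x. \<exists>n. (f ^^ n) x = 0}" using f0 by (auto intro: exI[of _ 0])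
  show "c *s x \<in> {x. \<exists>n. (f ^^ n) x = 0}" if "x \<in> {x. \<exists>n. (f ^^ n) x = 0}" for c x
    using that pair.linear_scale[OF lin] by fastforce
  fix x y assume "x \<in> {x. \<exists>n. (f ^^ n) x = 0}" "y \<in> {x. \<exists>n. (f ^^ n) x = 0}"
  then obtain n m where "(f ^^ n) x = 0" "(f ^^ m) y = 0" by blast
  then have "(f ^^ (max n m)) x = 0" "(f ^^ (max n m)) y = 0"
    using funpow_annihilated_mono[of f, OF f0] by (meson max.cobounded1 max.cobounded2)+
  then have "(f ^^ (max n m)) (x + y) = 0" using pair.linear_add[OF lin] by simp
  then show "x + y \<in> {x. \<exists>n. (f ^^ n) x = 0}" by blast
qed

end

text \<open>The bound \<open>k \<le> n\<close>, in place of \<open>k = n\<close>, lets the induction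
  hypothesis treat all earlier summands at once: they lie in the kernel of a power of
  \<open>T\<close>, and this kernel, being a closed subspace, contains the closure of their
  sum.\<close>

lemma nilpotent_on_summands:
  fixes smul :: "'f::real_normed_field \<Rightarrow> 'a::real_normed_vector \<Rightarrow> 'a"
  assumes "vector_space smul" "T \<in> bounded_ops smul"
    and "blinfun_apply T ` X 1 \<subseteq> {0}"
    and step: "\<And>n. n > 1 \<Longrightarrow> blinfun_apply T ` X n \<subseteq> closure (sum_of_subspaces smul X {1..<n})"
    and "k \<in> {1..n}" "x \<in> X k"
  shows "(blinfun_apply T ^^ n) x = 0"
  using assms(5,6)
proof (induction n arbitrary: k x)
  case (Suc n)
  interpret vector_space smul by fact
  interpret pair: vector_space_pair smul smul by unfold_locales
  let ?K = "{x. (blinfun_apply T ^^ n) x = 0}"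
  have lin: "Vector_Spaces.linear smul smul (blinfun_apply T ^^ n)"
    using assms(2) by (intro linear_funpow) (simp add: bounded_ops_def)
  have "blinfun_apply T x \<in> ?K"
  proof (cases "k = 1")
    case True
    then show ?thesis using assms(3) Suc.prems pair.linear_0[OF lin] by auto
  next
    case False
    have "closed ?K"
      unfolding blinfun_apply_power[symmetric] by (intro closed_Collect_eq continuous_intros)
    moreover have "sum_of_subspaces smul X {1..<k} \<subseteq> ?K"
      unfolding sum_of_subspaces_def
    proof (rule span_minimal)
      show "(\<Union>i\<in>{1..<k}. X i) \<subseteq> ?K" using Suc by force
      show "subspace ?K" by (rule pair.linear_subspace_kernel[OF lin])
    qed
    ultimately have "closure (sum_of_subspaces smul X {1..<k}) \<subseteq> ?K" by (rule closure_minimal[rotated])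
    then show ?thesis using step[of k] False Suc.prems by auto
  qed
  then show ?case by (simp add: funpow_swap1)
qed simp

lemma nullOrb_subset_bounded_ops:
  assumes "vector_space smul" "T \<in> bounded_ops smul"
  shows "nullOrb T \<subseteq> bounded_ops smul"
proof -
  interpret vector_space smul by fact
  interpret pair: vector_space_pair smul smul by unfold_locales
  show ?thesis
    using assms(2) linear_funpow[of "blinfun_apply T"] pair.linear_zero
    by (auto simp: nullOrb_def bounded_ops_def blinfun_apply_power zero_blinfun.rep_eq)
qed

text \<open>Evaluation at a vector is continuous for the strong operator topology, so it maps the
  closure of a set into the closure of its image.\<close>

lemma sot_closure_subset_nullOrbRef:
  "subtopology strong_operator_topology (bounded_ops smul) closure_of nullOrb T \<subseteq> nullOrbRef smul T"
proof
  fix S assume S: "S \<in> subtopology strong_operator_topology (bounded_ops smul) closure_of nullOrb T"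
  have "blinfun_apply S x \<in> closure ((\<lambda>A. blinfun_apply A x) ` nullOrb T)" for x
  proof -
    have "continuous_map (subtopology strong_operator_topology (bounded_ops smul)) euclidean
        (\<lambda>A. blinfun_apply A x)"
      by (intro continuous_map_from_subtopology strong_operator_topology_continuous_evaluation)
    from continuous_map_image_closure_subset[OF this, of "nullOrb T"] S
    show ?thesis by auto
  qed
  moreover have "S \<in> bounded_ops smul"
    using S closure_of_subset_topspace by fastforce
  ultimately show "S \<in> nullOrbRef smul T" by (simp add: nullOrbRef_def)
qed

theorem corollary11:
  fixes smul :: "'f::real_normed_field \<Rightarrow> 'a::real_normed_vector \<Rightarrow> 'a"
    and X :: "nat \<Rightarrow> 'a set"
    and T :: "'a \<Rightarrow>\<^sub>L 'a"
  assumes "normed_space_over smul"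
    and "is_direct_sum smul X {1..}"
    and "T \<in> bounded_ops smul"
    and "blinfun_apply T ` X 1 = {0}"
    and "\<And>n. n > 1 \<Longrightarrow> blinfun_apply T ` X n \<subseteq> closure (sum_of_subspaces smul X {1..<n})"
  shows "null_orbit_reflexive smul T \<and> nullOrbRef smul T = nullOrb T"
proof -
  interpret normed_space_over smul by fact
  have vs: "vector_space smul" by unfold_locales
  let ?D = "{x. \<exists>n. (blinfun_apply T ^^ n) x = 0}"
  have "sum_of_subspaces smul X {1..} \<subseteq> ?D"
    unfolding sum_of_subspaces_def
  proof (rule span_minimal)
    show "subspace ?D"
      using assms(3) by (intro subspace_nilpotent_vectors) (simp add: bounded_ops_def)
    have "(blinfun_apply T ^^ k) x = 0" if "1 \<le> k" "x \<in> X k" for k x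
      using nilpotent_on_summands[OF vs assms(3) _ assms(5), of k k x] assms(4) that by simp
    then show "(\<Union>k\<in>{1..}. X k) \<subseteq> ?D" by auto
  qed
  then have "closure ?D = UNIV"
    using assms(2) closure_mono unfolding is_direct_sum_def by blast
  then have sub: "nullOrbRef smul T \<subseteq> nullOrb T"
    using nullOrb_of_dense_nilpotent by (auto simp: nullOrbRef_def)
  have bd: "nullOrb T \<subseteq> bounded_ops smul"
    by (rule nullOrb_subset_bounded_ops[OF vs assms(3)])
  \<comment> \<open>This closes a cycle of inclusions: \<open>nullOrb T\<close> lies in its strong
    closure, which lies in \<open>nullOrbRef smul T\<close>, which lies in \<open>nullOrb T\<close>.
    Since \<open>closure_of\<close> only sees points of the subtopology, \<open>bd\<close> enters
    here.\<close>
  have "nullOrb T \<subseteq> subtopology strong_operator_topology (bounded_ops smul) closure_of nullOrb T"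
    using bd by (intro closure_of_subset) (simp add: strong_operator_topology_topspace)
  then show ?thesis
    using sub sot_closure_subset_nullOrbRef[of smul T] unfolding null_orbit_reflexive_def by blast
qed

end
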